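(* Let $m,n$ be positive integers. Let $f:N\to U$ be a $C^2$ immersion of a $C^2$ manifold $N$ of dimension $n$ into an open subset $U$ of $\mathbb{R}^m$. Let $F:U\to\mathbb{R}$ be a $C^2$ function. Then there exists a subset $\Sigma$ of $\mathcal{L}(\mathbb{R}^m,\mathbb{R})$ with Lebesgue measure zero such that for any $\pi\in\mathcal{L}(\mathbb{R}^m,\mathbb{R})-\Sigma$, the $C^2$ function $F_\pi\circ f:N\to\mathbb{R}$ is a Morse function.
   Context: All manifolds are without boundary and have countable bases. $\mathcal{L}(\mathbb{R}^m,\mathbb{R})$ is the space of all linear mappings $\mathbb{R}^m\to\mathbb{R}$, naturally identified with $\mathbb{R}^m$, which gives the meaning of Lebesgue measure zero. For $\pi\in\mathcal{L}(\mathbb{R}^m,\mathbb{R})$, $F_\pi=F+\pi|_U:U\to\mathbb{R}$. A $C^2$ function $g:N\to\mathbb{R}$ is called a Morse function if all of its critical points are nondegenerate. *)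

theory Defs
  imports "HOL-Analysis.Analysis"
begin

text \<open>\<open>C\<^sup>2\<close> maps between normed spaces; \<open>S\<close> is meant to be open.\<close>

definition C2_on ::
  "('a::real_normed_vector \<Rightarrow> 'b::real_normed_vector) \<Rightarrow> 'a set \<Rightarrow> bool" where
  "C2_on f S \<longleftrightarrow>
    (\<exists>(f' :: 'a \<Rightarrow> 'a \<Rightarrow>\<^sub>L 'b) (f'' :: 'a \<Rightarrow> 'a \<Rightarrow>\<^sub>L 'a \<Rightarrow>\<^sub>L 'b).
      (\<forall>x\<in>S. (f has_derivative blinfun_apply (f' x)) (at x)) \<and>
      (\<forall>x\<in>S. (f' has_derivative blinfun_apply (f'' x)) (at x)) \<and>
      continuous_on S f'')"

text \<open>
  A chart \<open>(V, \<phi>)\<close> of a topological space is a homeomorphism \<open>\<phi>\<close> of an open set \<open>V\<close> onto an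
  open set of \<open>\<real>\<^sup>n\<close>, where \<open>n = CARD('n)\<close> is automatically positive.
\<close>

type_synonym ('a, 'n) chart = "'a set \<times> ('a \<Rightarrow> real ^ 'n)"

definition is_chart :: "'a topology \<Rightarrow> ('a, 'n::finite) chart \<Rightarrow> bool" where
  "is_chart N c \<longleftrightarrow> (case c of (V, \<phi>) \<Rightarrow>
     openin N V \<and> open (\<phi> ` V) \<and>
     homeomorphic_map (subtopology N V) (top_of_set (\<phi> ` V)) \<phi>)"

text \<open>
  The representation of \<open>f\<close> in a chart, meaningful on \<open>\<phi> ` V\<close>.
\<close>

definition local_rep :: "('a \<Rightarrow> 'b) \<Rightarrow> ('a, 'n::finite) chart \<Rightarrow> real ^ 'n \<Rightarrow> 'b" where
  "local_rep f c = f \<circ> inv_into (fst c) (snd c)"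

text \<open>
  The atlas \<open>A\<close> need not be maximal. In the compatibility condition \<open>(V, \<phi>)\<close> and \<open>(W, \<psi>)\<close> range
  over ordered pairs, so each transition map and its inverse are both \<open>C\<^sup>2\<close>.
\<close>

definition C2_manifold :: "'a topology \<Rightarrow> ('a, 'n::finite) chart set \<Rightarrow> bool" where
  "C2_manifold N A \<longleftrightarrow>
     Hausdorff_space N \<and> second_countable N \<and>
     (\<forall>c\<in>A. is_chart N c) \<and>
     (\<Union>(V, \<phi>)\<in>A. V) = topspace N \<and>
     (\<forall>(V, \<phi>)\<in>A. \<forall>(W, \<psi>)\<in>A. C2_on (local_rep \<psi> (V, \<phi>)) (\<phi> ` (V \<inter> W)))"

definition C2_map ::
  "('a, 'n::finite) chart set \<Rightarrow> ('a \<Rightarrow> 'b::real_normed_vector) \<Rightarrow> bool" where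
  "C2_map A f \<longleftrightarrow> (\<forall>(V, \<phi>)\<in>A. C2_on (local_rep f (V, \<phi>)) (\<phi> ` V))"

definition C2_immersion ::
  "('a, 'n::finite) chart set \<Rightarrow> ('a \<Rightarrow> 'b::real_normed_vector) \<Rightarrow> bool" where
  "C2_immersion A f \<longleftrightarrow> C2_map A f \<and>
     (\<forall>(V, \<phi>)\<in>A. \<forall>p\<in>V. inj (frechet_derivative (local_rep f (V, \<phi>)) (at (\<phi> p))))"

definition hessian_matrix :: "(real ^ 'n::finite \<Rightarrow> real) \<Rightarrow> real ^ 'n \<Rightarrow> real ^ 'n ^ 'n" where
  "hessian_matrix g x = (\<chi> i j.
     frechet_derivative (\<lambda>y. frechet_derivative g (at y) (axis j 1)) (at x) (axis i 1))"

text \<open>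
  For \<open>C\<^sup>2\<close> functions neither of the next two notions depends on the chart around \<open>p\<close>. With the
  quantifiers chosen here, a Morse function is one for which a vanishing differential in any
  one chart entails a nonsingular Hessian in every chart.
\<close>

definition critical_point ::
  "('a, 'n::finite) chart set \<Rightarrow> ('a \<Rightarrow> real) \<Rightarrow> 'a \<Rightarrow> bool" where
  "critical_point A g p \<longleftrightarrow>
     (\<exists>(V, \<phi>)\<in>A. p \<in> V \<and> frechet_derivative (local_rep g (V, \<phi>)) (at (\<phi> p)) = (\<lambda>v. 0))"

definition nondegenerate_at ::
  "('a, 'n::finite) chart set \<Rightarrow> ('a \<Rightarrow> real) \<Rightarrow> 'a \<Rightarrow> bool" where
  "nondegenerate_at A g p \<longleftrightarrow>
     (\<forall>(V, \<phi>)\<in>A. p \<in> V \<longrightarrow> det (hessian_matrix (local_rep g (V, \<phi>)) (\<phi> p)) \<noteq> 0)"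

definition morse_function :: "('a, 'n::finite) chart set \<Rightarrow> ('a \<Rightarrow> real) \<Rightarrow> bool" where
  "morse_function A g \<longleftrightarrow> C2_map A g \<and>
     (\<forall>p. critical_point A g p \<longrightarrow> nondegenerate_at A g p)"

text \<open>
  The identification of the space of linear forms on \<open>\<real>\<^sup>m\<close> with \<open>\<real>\<^sup>m\<close>, through which
  Lebesgue null sets of linear forms are understood.
\<close>

definition form_coords :: "(real ^ 'm::finite \<Rightarrow> real) \<Rightarrow> real ^ 'm" where
  "form_coords \<pi> = (\<chi> i. \<pi> (axis i 1))"

end

theory Submission
  imports Defs
begin

text \<open>
  In a chart, let \<open>h\<close> represent the immersion. Since \<open>D h\<close> is injective, near each point some \<open>n\<close> of
  the \<open>m\<close> coordinates of \<open>h\<close> have an invertible Jacobian. The equation \<open>D (F \<circ> h) + \<pi> \<circ> D h = 0\<close>,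
  which is linear in \<open>\<pi>\<close>, then determines the corresponding \<open>n\<close> coefficients of \<open>\<pi>\<close> from \<open>x\<close> and the
  remaining \<open>m - n\<close> ones. So the pairs \<open>(x, \<pi>)\<close> with \<open>x\<close> critical are parametrised by \<open>m\<close> real
  variables, and the map \<open>\<Phi>\<close> from these parameters to \<open>\<pi>\<close> is differentiable. Differentiating the
  equation in a direction of the kernel of the Hessian shows that degenerate critical points are
  critical points of \<open>\<Phi>\<close>, whose values are negligible by Sard's theorem in equal dimensions.
  Countably many charts and finitely many choices of \<open>n\<close> coordinates suffice.
\<close>

section \<open>Sard's theorem in equal dimensions over an arbitrary finite index type\<close>

text \<open>The library proves Sard's theorem for well-ordered index types only; the following copy of an
  arbitrary finite type makes it available for all of them.\<close>

typedef 'a enumerated = "{..<CARD('a::finite)}"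
  morphisms enum_index of_enum_index
  by (rule exI[of _ 0]) simp

setup_lifting type_definition_enumerated

instantiation enumerated :: (finite) linorder
begin
lift_definition less_eq_enumerated :: "'a enumerated \<Rightarrow> 'a enumerated \<Rightarrow> bool" is "(\<le>)" .
lift_definition less_enumerated :: "'a enumerated \<Rightarrow> 'a enumerated \<Rightarrow> bool" is "(<)" .
instance by standard (transfer; auto)+
end

instance enumerated :: (finite) finite
proof
  have "bij_betw enum_index (UNIV :: 'a enumerated set) {..<CARD('a)}"
    unfolding bij_betw_def
    using type_definition.Rep_range[OF type_definition_enumerated]
    by (auto intro: inj_onI simp: enum_index_inject)
  then show "finite (UNIV :: 'a enumerated set)"
    using bij_betw_finite by blast
qed

instance enumerated :: (finite) wellorder
proof
  fix P :: "'a enumerated \<Rightarrow> bool" and a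
  assume step: "\<And>x. (\<And>y. y < x \<Longrightarrow> P y) \<Longrightarrow> P x"
  show "P a"
    by (induction a rule: measure_induct_rule[of enum_index])
      (use step in \<open>auto simp: less_enumerated.rep_eq\<close>)
qed

lemma card_enumerated: "CARD('a enumerated) = CARD('a::finite)"
  using type_definition.card[OF type_definition_enumerated] by simp

text \<open>Relabelling coordinates along a bijection \<open>b\<close> conjugates \<open>f\<close>
  to a map between subsets of \<open>real^'m enumerated\<close>, where \<open>baby_Sard\<close>
  applies because a noninjective linear map of a space to itself has deficient rank. The linear map
  \<open>Q\<close> carries the negligible image back, since it joins spaces of the same
  dimension.\<close>

lemma negligible_image_singular:
  fixes f :: "real^'m::finite \<Rightarrow> real^'m"
  assumes der: "\<And>x. x \<in> S \<Longrightarrow> (f has_derivative f' x) (at x within S)"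
    and sing: "\<And>x. x \<in> S \<Longrightarrow> \<not> inj (f' x)"
  shows "negligible (f ` S)"
proof -
  obtain b :: "'m \<Rightarrow> 'm enumerated" where b: "bij b"
    using card_enumerated[where 'a='m] by (metis finite finite_same_card_bij)
  define P :: "real^'m \<Rightarrow> real^'m enumerated" where "P x = (\<chi> i. x $ inv b i)" for x
  define Q :: "real^'m enumerated \<Rightarrow> real^'m" where "Q y = (\<chi> i. y $ b i)" for y
  have PQ [simp]: "P (Q y) = y" and QP [simp]: "Q (P x) = x" for x y
    using b by (auto simp: P_def Q_def vec_eq_iff bij_is_surj surj_f_inv_f bij_is_inj)
  have linP: "linear P" and linQ: "linear Q"
    by (auto intro!: linearI simp: P_def Q_def vec_eq_iff)
  have Q_img: "Q ` P ` S = S" by (force simp: image_image)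
  have "negligible ((P \<circ> f \<circ> Q) ` P ` S)"
  proof (rule baby_Sard)
    fix y assume "y \<in> P ` S"
    then have Qy: "Q y \<in> S" by auto
    have "(Q has_derivative Q) (at y within P ` S)"
      using linQ by (simp add: linear_imp_has_derivative)
    from has_derivative_in_compose[OF this, of f "f' (Q y)"] der[OF Qy]
    have "((\<lambda>y. f (Q y)) has_derivative (\<lambda>v. f' (Q y) (Q v))) (at y within P ` S)"
      by (simp add: Q_img)
    from bounded_linear.has_derivative[OF _ this, of P] linP
    show der': "((P \<circ> f \<circ> Q) has_derivative (P \<circ> f' (Q y) \<circ> Q)) (at y within P ` S)"
      by (simp add: linear_linear o_def)
    have "\<not> inj (P \<circ> f' (Q y) \<circ> Q)"
    proof
      assume inj: "inj (P \<circ> f' (Q y) \<circ> Q)"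
      have "inj (f' (Q y))"
      proof (rule injI)
        fix u v assume "f' (Q y) u = f' (Q y) v"
        then have "(P \<circ> f' (Q y) \<circ> Q) (P u) = (P \<circ> f' (Q y) \<circ> Q) (P v)" by simp
        then have "P u = P v" using inj by (rule injD[rotated])
        then show "u = v" by (metis QP)
      qed
      with sing[OF Qy] show False ..
    qed
    moreover have "linear (P \<circ> f' (Q y) \<circ> Q)"
      using der' has_derivative_linear by blast
    ultimately show "rank (matrix (P \<circ> f' (Q y) \<circ> Q)) < CARD('m enumerated)"
      by (simp add: less_rank_noninjective)
  qed simp
  then have "negligible (Q ` (P \<circ> f \<circ> Q) ` P ` S)"
    by (rule negligible_differentiable_image_negligible[rotated])
      (use linQ in \<open>auto simp: card_enumerated linear_imp_differentiable_on\<close>)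
  also have "Q ` (P \<circ> f \<circ> Q) ` P ` S = f ` S"
    by (simp add: image_image)
  finally show ?thesis .
qed

section \<open>Differentiable dependence of the solution of a linear system on its
  coefficients\<close>

lemma differentiable_det:
  fixes T :: "'a::real_normed_vector \<Rightarrow> real^'m^'m"
  assumes "\<And>i j. (\<lambda>y. T y $ i $ j) differentiable (at x within S)"
  shows "(\<lambda>y. det (T y)) differentiable (at x within S)"
proof -
  obtain D where D: "\<And>i j. ((\<lambda>y. T y $ i $ j) has_derivative D i j) (at x within S)"
    using assms unfolding differentiable_def by metis
  have "(\<lambda>y. \<Prod>i\<in>UNIV. T y $ i $ p i) differentiable (at x within S)" for p :: "'m \<Rightarrow> 'm"
    by (rule differentiableI[OF has_derivative_prod[where f'="\<lambda>i. D i (p i)"]]) (rule D)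
  then have "(\<lambda>y. of_int (sign p) * (\<Prod>i\<in>UNIV. T y $ i $ p i)) differentiable (at x within S)"
    for p :: "'m \<Rightarrow> 'm"
    by (rule differentiable_mult[OF differentiable_const])
  then show ?thesis
    unfolding det_def by (simp add: differentiable_sum finite_permutations)
qed

text \<open>Cramer's rule exhibits every coordinate of \<open>s\<close> as a quotient of two
  determinants with differentiable entries.\<close>

lemma differentiable_linear_system_solution:
  fixes T :: "'a::real_normed_vector \<Rightarrow> real^'m^'m" and s w :: "'a \<Rightarrow> real^'m"
  assumes x: "x \<in> S"
    and sol: "\<And>y. y \<in> S \<Longrightarrow> T y *v s y = w y"
    and det: "\<And>y. y \<in> S \<Longrightarrow> det (T y) \<noteq> 0"
    and T: "\<And>i j. (\<lambda>y. T y $ i $ j) differentiable (at x within S)"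
    and w: "\<And>i. (\<lambda>y. w y $ i) differentiable (at x within S)"
  shows "s differentiable (at x within S)"
proof -
  have "(\<lambda>y. s y $ k) differentiable (at x within S)" for k
  proof -
    let ?M = "\<lambda>y. (\<chi> i j. if j = k then w y $ i else T y $ i $ j) :: real^'m^'m"
    have "(\<lambda>y. ?M y $ i $ j) differentiable (at x within S)" for i j
      using T w by (cases "j = k") auto
    then have "(\<lambda>y. det (?M y)) differentiable (at x within S)"
      by (rule differentiable_det)
    then have "(\<lambda>y. det (?M y) / det (T y)) differentiable (at x within S)"
      using differentiable_det[OF T] det[OF x] by (intro differentiable_divide)
    moreover have "det (?M y) / det (T y) = s y $ k" if "y \<in> S" for y
    proof -
      have "s y = (\<chi> k. det (\<chi> i j. if j = k then w y $ i else T y $ i $ j) / det (T y))"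
        using sol[OF that] cramer[OF det[OF that]] by blast
      then show ?thesis by (metis (no_types, lifting) vec_lambda_beta)
    qed
    ultimately show ?thesis
      unfolding differentiable_def
      by (metis (no_types, lifting) has_derivative_transform x)
  qed
  then show ?thesis
    unfolding differentiable_componentwise_within[of s]
    by (auto simp: Basis_vec_def inner_axis)
qed

section \<open>Selecting coordinates in which an injective linear map stays injective\<close>

text \<open>The coordinates outside \<open>range e\<close> span a complement of the range of \<open>D\<close>.\<close>

lemma coordinate_complement_of_range:
  fixes D :: "real^'n::finite \<Rightarrow> real^'m::finite"
  assumes lin: "linear D" and inj: "inj D"
  obtains e :: "'n \<Rightarrow> 'm" where "inj e"
    "\<forall>a. (\<forall>j. j \<notin> range e \<longrightarrow> a $ j = 0) \<and> (\<forall>k. a \<bullet> D k = 0) \<longrightarrow> a = 0"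
proof -
  let ?A = "matrix D"
  have D: "D v = ?A *v v" for v using lin by simp
  \<comment> \<open>Injectivity gives full column rank, hence row rank \<open>CARD('n)\<close>;
    \<open>e\<close> will list the indices of rows that form a basis of the row space.\<close>
  have "dim (rows ?A) = CARD('n)"
    using inj full_rank_injective[of ?A] lin by (simp add: row_rank_def)
  then obtain B where B: "B \<subseteq> rows ?A" "independent B" "card B = CARD('n)"
    using basis_exists[of "rows ?A"] by metis
  have finB: "finite B" using B(3) by (metis card.infinite finite_UNIV_card_ge_0 finite less_irrefl)
  obtain \<beta> :: "'n \<Rightarrow> real^'n" where \<beta>: "bij_betw \<beta> UNIV B"
    using finite_same_card_bij[of "UNIV::'n set" B] finB B(3) by auto
  have "\<exists>i. row i ?A = \<beta> k" for k
  proof -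
    have "\<beta> k \<in> rows ?A" using \<beta> B(1) by (auto simp: bij_betw_def)
    then show ?thesis unfolding rows_def by auto
  qed
  then obtain e where e: "\<And>k. row (e k) ?A = \<beta> k" by metis
  have "inj e"
    using \<beta> by (metis bij_betw_imp_inj_on e injD injI)
  moreover have "a = 0" if off: "\<And>j. j \<notin> range e \<Longrightarrow> a $ j = 0" and orth: "\<And>k. a \<bullet> D k = 0" for a
  proof -
    \<comment> \<open>Orthogonality to the range of \<open>D\<close> is a linear relation among the
      rows with coefficients from \<open>a\<close>. As \<open>a\<close> is supported on
      \<open>range e\<close>, the relation involves independent rows only, so all its coefficients
      vanish.\<close>
    have sum0: "(\<Sum>j\<in>UNIV. a $ j *\<^sub>R row j ?A) = 0"
    proof (rule vector_eq_ldot[THEN iffD1, rule_format])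
      fix k
      have "k \<bullet> (\<Sum>j\<in>UNIV. a $ j *\<^sub>R row j ?A) = (\<Sum>j\<in>UNIV. a $ j * (row j ?A \<bullet> k))"
        by (simp add: inner_sum_right inner_commute)
      also have "\<dots> = a \<bullet> (?A *v k)"
        by (simp only: inner_vec_def[of a] matrix_vector_mul_component inner_real_def row_def vec_nth_inverse)
      also have "\<dots> = 0" using orth[of k] D[of k] by simp
      finally show "k \<bullet> (\<Sum>j\<in>UNIV. a $ j *\<^sub>R row j ?A) = k \<bullet> 0" by simp
    qed
    moreover have "(\<Sum>j\<in>UNIV. a $ j *\<^sub>R row j ?A) = (\<Sum>j\<in>range e. a $ j *\<^sub>R row j ?A)"
      by (rule sum.mono_neutral_right) (use off in auto)
    moreover have "\<dots> = (\<Sum>k\<in>UNIV. a $ e k *\<^sub>R \<beta> k)"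
      using \<open>inj e\<close> by (simp add: sum.reindex e)
    moreover have "\<dots> = (\<Sum>b\<in>B. a $ e (inv_into UNIV \<beta> b) *\<^sub>R b)"
      using \<beta> by (subst sum.reindex_bij_betw[OF \<beta>, symmetric])
        (simp add: bij_betw_imp_inj_on)
    ultimately have "(\<Sum>b\<in>B. a $ e (inv_into UNIV \<beta> b) *\<^sub>R b) = 0" using sum0 by metis
    then have "a $ e (inv_into UNIV \<beta> b) = 0" if "b \<in> B" for b
      using independentD[OF B(2) finB order_refl _ that, of "\<lambda>b. a $ e (inv_into UNIV \<beta> b)"] by simp
    then have "a $ e k = 0" for k
      by (metis \<beta> bij_betw_apply bij_betw_imp_inj_on inv_f_f UNIV_I)
    then show "a = 0" using off by (metis imageE vec_eq_iff zero_index)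
  qed
  ultimately show ?thesis using that by blast
qed

section \<open>Second-order calculus and kernels of Hessians\<close>

text \<open>The existential witnesses of \<open>C2_on\<close> become arguments, so that later
  statements can name both derivatives and relate them by formulas.\<close>

definition C2_derivs ::
  "('a::real_normed_vector \<Rightarrow> 'b::real_normed_vector) \<Rightarrow> ('a \<Rightarrow> 'a \<Rightarrow>\<^sub>L 'b) \<Rightarrow>
    ('a \<Rightarrow> 'a \<Rightarrow>\<^sub>L 'a \<Rightarrow>\<^sub>L 'b) \<Rightarrow> 'a set \<Rightarrow> bool" where
  "C2_derivs f f' f'' S \<longleftrightarrow>
     (\<forall>x\<in>S. (f has_derivative blinfun_apply (f' x)) (at x)) \<and>
     (\<forall>x\<in>S. (f' has_derivative blinfun_apply (f'' x)) (at x)) \<and>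
     continuous_on S f''"

lemma C2_on_iff_C2_derivs: "C2_on f S \<longleftrightarrow> (\<exists>f' f''. C2_derivs f f' f'' S)"
  by (simp add: C2_on_def C2_derivs_def)

lemma C2_derivsD:
  assumes "C2_derivs f f' f'' S" "x \<in> S"
  shows "(f has_derivative blinfun_apply (f' x)) (at x)"
    "(f' has_derivative blinfun_apply (f'' x)) (at x)"
  using assms by (auto simp: C2_derivs_def)

lemma C2_derivs_continuous:
  assumes "C2_derivs f f' f'' S"
  shows "continuous_on S f" "continuous_on S f'" "continuous_on S f''"
  using assms unfolding C2_derivs_def
  by (meson continuous_at_imp_continuous_on has_derivative_continuous)+

lemma C2_derivs_cong:
  assumes "C2_derivs f f' f'' S" "open S" "\<And>x. x \<in> S \<Longrightarrow> f x = g x"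
  shows "C2_derivs g f' f'' S"
  using assms unfolding C2_derivs_def
  by (metis has_derivative_transform_within_open)

lemma C2_derivs_frechet:
  assumes "C2_derivs f f' f'' S" "x \<in> S"
  shows "frechet_derivative f (at x) = blinfun_apply (f' x)"
  using frechet_derivative_at[OF C2_derivsD(1)[OF assms]] by simp

lemma C2_derivs_frechet_eq_0_iff:
  assumes "C2_derivs f f' f'' S" "x \<in> S"
  shows "frechet_derivative f (at x) = (\<lambda>v. 0) \<longleftrightarrow> f' x = 0"
  by (simp add: C2_derivs_frechet[OF assms] flip: zero_blinfun.rep_eq blinfun_apply_inject)

text \<open>The second derivative comes from the product rule applied to
  \<open>f' (g x) o\<^sub>L g' x\<close>. It is exported as a formula because two facts are read off
  from it later: how it depends on a linear perturbation of \<open>f\<close>, and that its first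
  summand vanishes where \<open>f' (g x) = 0\<close>.\<close>

lemma C2_derivs_compose:
  fixes g :: "'a::euclidean_space \<Rightarrow> 'b::real_normed_vector" and f :: "'b \<Rightarrow> 'c::real_normed_vector"
  assumes g: "C2_derivs g g' g'' S" and f: "C2_derivs f f' f'' T" and gST: "g ` S \<subseteq> T"
  obtains h'' where "C2_derivs (f \<circ> g) (\<lambda>x. f' (g x) o\<^sub>L g' x) h'' S"
    "\<And>x v. h'' x v = (f' (g x) o\<^sub>L g'' x v) + (f'' (g x) (g' x v) o\<^sub>L g' x)"
proof -
  define h'' where "h'' x = Blinfun (\<lambda>v. (f' (g x) o\<^sub>L g'' x v) + (f'' (g x) (g' x v) o\<^sub>L g' x))" for x
  have "bounded_linear (\<lambda>v. (f' (g x) o\<^sub>L g'' x v) + (f'' (g x) (g' x v) o\<^sub>L g' x))" for x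
    by (intro bounded_linear_add
        bounded_linear_compose[OF bounded_bilinear.bounded_linear_right[OF bounded_bilinear_blinfun_compose]]
        bounded_linear_compose[OF bounded_bilinear.bounded_linear_left[OF bounded_bilinear_blinfun_compose]]
        bounded_linear_compose[OF blinfun.bounded_linear_right] blinfun.bounded_linear_right)
  then have app: "h'' x v = (f' (g x) o\<^sub>L g'' x v) + (f'' (g x) (g' x v) o\<^sub>L g' x)" for x v
    by (simp add: h''_def bounded_linear_Blinfun_apply)
  have "((f \<circ> g) has_derivative blinfun_apply (f' (g x) o\<^sub>L g' x)) (at x)" if "x \<in> S" for x
    using diff_chain_at[OF C2_derivsD(1)[OF g that] C2_derivsD(1)[OF f]] gST that
    by (simp add: o_def blinfun_compose.rep_eq image_subset_iff)
  moreover have "((\<lambda>x. f' (g x) o\<^sub>L g' x) has_derivative blinfun_apply (h'' x)) (at x)" if "x \<in> S" for x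
  proof -
    have "((\<lambda>x. f' (g x)) has_derivative (\<lambda>v. f'' (g x) (g' x v))) (at x)"
      using has_derivative_compose[OF C2_derivsD(1)[OF g that] C2_derivsD(2)[OF f]] gST that by auto
    from bounded_bilinear.FDERIV[OF bounded_bilinear_blinfun_compose this C2_derivsD(2)[OF g that]]
    show ?thesis by (rule has_derivative_eq_rhs) (simp add: app fun_eq_iff)
  qed
  \<comment> \<open>On a Euclidean domain, continuity of an operator-valued map may be tested on
    each vector \<open>v\<close>.\<close>
  moreover have "continuous_on S h''"
  proof (rule continuous_on_blinfun_componentwise)
    fix v :: 'a
    note cg = C2_derivs_continuous[OF g]
    have cf: "continuous_on S (\<lambda>x. f' (g x))" "continuous_on S (\<lambda>x. f'' (g x))"
      using continuous_on_compose2[OF C2_derivs_continuous(2)[OF f] cg(1) gST]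
        continuous_on_compose2[OF C2_derivs_continuous(3)[OF f] cg(1) gST] .
    show "continuous_on S (\<lambda>x. h'' x v)"
      unfolding app by (intro continuous_intros bounded_bilinear.continuous_on[OF bounded_bilinear_blinfun_compose] cf cg)
  qed
  ultimately have "C2_derivs (f \<circ> g) (\<lambda>x. f' (g x) o\<^sub>L g' x) h'' S"
    by (simp add: C2_derivs_def)
  then show ?thesis using that app by blast
qed

lemma C2_derivs_add_inner:
  fixes f :: "'a::real_inner \<Rightarrow> real"
  assumes "C2_derivs f f' f'' S"
  shows "C2_derivs (\<lambda>x. f x + a \<bullet> x) (\<lambda>x. f' x + blinfun_inner_right a) f'' S"
proof -
  have "((\<lambda>x. f x + a \<bullet> x) has_derivative blinfun_apply (f' x + blinfun_inner_right a)) (at x)"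
    if "x \<in> S" for x
    by (rule has_derivative_eq_rhs[OF has_derivative_add[OF C2_derivsD(1)[OF assms that]
          has_derivative_inner_right[OF has_derivative_ident, of a]]])
      (simp add: blinfun.add_left fun_eq_iff)
  moreover have "((\<lambda>x. f' x + blinfun_inner_right a) has_derivative blinfun_apply (f'' x)) (at x)"
    if "x \<in> S" for x
    using has_derivative_add[OF C2_derivsD(2)[OF assms that] has_derivative_const[of "blinfun_inner_right a"]] by simp
  ultimately show ?thesis
    using assms by (simp add: C2_derivs_def)
qed

lemma hessian_matrix_C2_derivs:
  fixes g :: "real^'n::finite \<Rightarrow> real"
  assumes g: "C2_derivs g g' g'' S" and S: "open S" "x \<in> S"
  shows "hessian_matrix g x $ i $ j = g'' x (axis i 1) (axis j 1)"
proof -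
  have "((\<lambda>y. g' y (axis j 1)) has_derivative (\<lambda>h. g'' x h (axis j 1))) (at x)"
    by (rule bounded_linear.has_derivative[OF blinfun.bounded_linear_left C2_derivsD(2)[OF g S(2)]])
  then have "((\<lambda>y. frechet_derivative g (at y) (axis j 1)) has_derivative (\<lambda>h. g'' x h (axis j 1))) (at x)"
    by (rule has_derivative_transform_within_open[OF _ S]) (simp add: C2_derivs_frechet[OF g])
  from frechet_derivative_at[OF this, symmetric] show ?thesis
    by (simp add: hessian_matrix_def)
qed

text \<open>The row index of \<open>hessian_matrix\<close> is the first argument of
  \<open>g'' x\<close>, so \<open>v \<mapsto> g'' x v\<close> has the transposed Hessian as its
  matrix, with the same determinant. Degeneracy thereby becomes a nonzero kernel vector, a direction
  in which to differentiate.\<close>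

lemma det_hessian_eq_0_iff:
  fixes g :: "real^'n::finite \<Rightarrow> real"
  assumes g: "C2_derivs g g' g'' S" and S: "open S" "x \<in> S"
  shows "det (hessian_matrix g x) = 0 \<longleftrightarrow> (\<exists>v. v \<noteq> 0 \<and> g'' x v = 0)"
proof -
  let ?H = "hessian_matrix g x"
  have H: "(transpose ?H *v v) $ j = g'' x v (axis j 1)" for v j
  proof -
    have "g'' x v = g'' x (\<Sum>i\<in>UNIV. v $ i *\<^sub>R axis i 1)"
      by (metis basis_expansion scalar_mult_eq_scaleR)
    then show ?thesis
      by (simp add: matrix_vector_mult_def transpose_def hessian_matrix_C2_derivs[OF assms]
          blinfun.sum_right blinfun.sum_left blinfun.scaleR_right blinfun.scaleR_left mult.commute)
  qed
  have "transpose ?H *v v = 0 \<longleftrightarrow> g'' x v = 0" for v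
  proof -
    have "transpose ?H *v v = 0 \<longleftrightarrow> (\<forall>b\<in>Basis. g'' x v b = 0)"
      by (simp add: vec_eq_iff H[unfolded transpose_matrix_vector] Basis_vec_def)
    also have "\<dots> \<longleftrightarrow> g'' x v = 0"
      by (auto intro: blinfun_euclidean_eqI)
    finally show ?thesis .
  qed
  moreover have "det (transpose ?H) = 0 \<longleftrightarrow> (\<exists>v. v \<noteq> 0 \<and> transpose ?H *v v = 0)"
    using invertible_det_nz[of "transpose ?H"] matrix_left_invertible_ker[of "transpose ?H"]
      invertible_left_inverse[of "transpose ?H"] by blast
  ultimately show ?thesis by (simp add: det_transpose)
qed

section \<open>Degenerate perturbations in a single chart\<close>

text \<open>For a fixed choice \<open>e\<close>, the first condition on \<open>x\<close> makes the
  critical-point equation uniquely solvable for the coefficients in \<open>range e\<close>. The bad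
  vectors \<open>a\<close> then are values of \<open>\<Phi>\<close> at points where its derivative
  is singular.\<close>

lemma degenerate_perturbations_negligible_coord:
  fixes h :: "real^'n::finite \<Rightarrow> real^'m::finite" and G :: "real^'n \<Rightarrow> real" and e :: "'n \<Rightarrow> 'm"
  assumes h: "C2_derivs h h' h'' S" and G: "C2_derivs G G' G'' S" and S: "open S" and e: "inj e"
  shows "negligible {a. \<exists>x\<in>S. (\<forall>b. (\<forall>j. j \<notin> range e \<longrightarrow> b $ j = 0) \<and> (\<forall>k. b \<bullet> h' x k = 0) \<longrightarrow> b = 0) \<and>
      (\<forall>k. G' x k + a \<bullet> h' x k = 0) \<and> (\<exists>v. v \<noteq> 0 \<and> (\<forall>k. G'' x v k + a \<bullet> h'' x v k = 0))}"
    (is "negligible ?Bad")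
proof -
  \<comment> \<open>A parameter \<open>u\<close> encodes \<open>x\<close> in its coordinates in \<open>range e\<close> and those of \<open>\<pi>\<close> in the others.\<close>
  define \<xi> :: "real^'m \<Rightarrow> real^'n" where "\<xi> u = (\<chi> i. u $ e i)" for u
  \<comment> \<open>In the system \<open>T u *v a = w u\<close>, the rows in \<open>range e\<close>
    are the critical-point equations at \<open>\<xi> u\<close>, tested on the axes, and the
    remaining rows fix \<open>a $ j = u $ j\<close>. On \<open>R\<close> its unique solution is
    \<open>\<Phi> u\<close>.\<close>
  define T :: "real^'m \<Rightarrow> real^'m^'m" where
    "T u = (\<chi> j. if j \<in> range e then h' (\<xi> u) (axis (inv e j) 1) else axis j 1)" for u
  define w :: "real^'m \<Rightarrow> real^'m" where
    "w u = (\<chi> j. if j \<in> range e then - G' (\<xi> u) (axis (inv e j) 1) else u $ j)" for u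
  define \<Phi> :: "real^'m \<Rightarrow> real^'m" where "\<Phi> u = matrix_inv (T u) *v w u" for u
  define R where "R = {u. \<xi> u \<in> S \<and> det (T u) \<noteq> 0}"
  define Q where "Q = {u \<in> R. \<exists>v. v \<noteq> 0 \<and> (\<forall>k. G'' (\<xi> u) v k + \<Phi> u \<bullet> h'' (\<xi> u) v k = 0)}"

  have lin: "bounded_linear \<xi>"
    by (auto intro!: linearI simp: \<xi>_def vec_eq_iff simp flip: linear_conv_bounded_linear)
  have row: "(T u *v a) $ j = (if j \<in> range e then a \<bullet> h' (\<xi> u) (axis (inv e j) 1) else a $ j)" for u a j
    by (simp add: matrix_vector_mul_component T_def inner_commute inner_axis)
  have row_eq: "T u *v a = w u \<longleftrightarrow>
      (\<forall>i. G' (\<xi> u) (axis i 1) + a \<bullet> h' (\<xi> u) (axis i 1) = 0) \<and> (\<forall>j. j \<notin> range e \<longrightarrow> a $ j = u $ j)" for u a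
  proof -
    have "(T u *v a) $ j = w u $ j \<longleftrightarrow> (if j \<in> range e
        then G' (\<xi> u) (axis (inv e j) 1) + a \<bullet> h' (\<xi> u) (axis (inv e j) 1) = 0 else a $ j = u $ j)" for j
      by (simp add: row w_def eq_neg_iff_add_eq_0 add.commute)
    then have "T u *v a = w u \<longleftrightarrow> (\<forall>j. if j \<in> range e
        then G' (\<xi> u) (axis (inv e j) 1) + a \<bullet> h' (\<xi> u) (axis (inv e j) 1) = 0 else a $ j = u $ j)"
      unfolding vec_eq_iff by blast
    then show ?thesis using e by (force split: if_splits)
  qed
  have T_solve: "T u *v a = b \<longleftrightarrow> a = matrix_inv (T u) *v b" if "u \<in> R" for u a b
  proof -
    have "invertible (T u)" using that by (simp add: R_def invertible_det_nz)
    then have "T u ** matrix_inv (T u) = mat 1 \<and> matrix_inv (T u) ** T u = mat 1"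
      unfolding invertible_def matrix_inv_def by (rule someI_ex)
    then show ?thesis
      by (metis matrix_vector_mul_assoc matrix_vector_mul_lid)
  qed
  have der_\<xi>: "((\<lambda>u. f (\<xi> u)) has_derivative (\<lambda>k. f' (\<xi> k))) (at u)"
    if "(f has_derivative f') (at (\<xi> u))" for f :: "real^'n \<Rightarrow> 'z::real_normed_vector" and f' u
    using has_derivative_compose[OF bounded_linear_imp_has_derivative[OF lin] that] .
  have der_h: "((\<lambda>u. h' (\<xi> u) k) has_derivative (\<lambda>d. h'' (\<xi> u) (\<xi> d) k)) (at u)" if "\<xi> u \<in> S" for u k
    by (rule bounded_linear.has_derivative[OF blinfun.bounded_linear_left der_\<xi>[OF C2_derivsD(2)[OF h that]]])
  have der_G: "((\<lambda>u. G' (\<xi> u) k) has_derivative (\<lambda>d. G'' (\<xi> u) (\<xi> d) k)) (at u)" if "\<xi> u \<in> S" for u k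
    by (rule bounded_linear.has_derivative[OF blinfun.bounded_linear_left der_\<xi>[OF C2_derivsD(2)[OF G that]]])
  have diff_T: "(\<lambda>u. T u $ i $ j) differentiable (at u)" if "\<xi> u \<in> S" for u i j
    using bounded_linear.has_derivative[OF bounded_linear_vec_nth der_h[OF that]]
    by (cases "i \<in> range e") (auto simp: T_def intro: differentiableI)
  have diff_w: "(\<lambda>u. w u $ j) differentiable (at u)" if "\<xi> u \<in> S" for u j
    using has_derivative_minus[OF der_G[OF that]] bounded_linear_imp_differentiable[OF bounded_linear_vec_nth]
    by (cases "j \<in> range e") (auto simp: w_def intro: differentiableI)
  \<comment> \<open>Openness of \<open>R\<close> lets identities that hold on \<open>R\<close>, such
    as \<open>sol\<close>, be differentiated at its points.\<close>
  have "open (\<xi> -` S)"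
    using S lin by (simp add: linear_continuous_on open_vimage)
  have "continuous_on (\<xi> -` S) (\<lambda>u. det (T u))"
    by (intro continuous_at_imp_continuous_on ballI differentiable_imp_continuous_within differentiable_det diff_T) auto
  then have "open (\<xi> -` S \<inter> (\<lambda>u. det (T u)) -` (- {0}))"
    using \<open>open (\<xi> -` S)\<close> by (intro continuous_open_preimage) auto
  also have "\<xi> -` S \<inter> (\<lambda>u. det (T u)) -` (- {0}) = R"
    by (auto simp: R_def)
  finally have "open R" .
  have sol: "T u *v \<Phi> u = w u" if "u \<in> R" for u
    using T_solve[OF that] \<Phi>_def by blast
  have diff_\<Phi>: "\<Phi> differentiable (at u)" if u: "u \<in> R" for u
  proof -
    have uS: "\<xi> u \<in> S" using u by (simp add: R_def)
    have "\<Phi> differentiable (at u within R)"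
      by (rule differentiable_linear_system_solution[OF u sol _
            differentiable_at_withinI[OF diff_T[OF uS]] differentiable_at_withinI[OF diff_w[OF uS]]])
        (simp_all add: R_def)
    then show ?thesis using at_within_open[OF u \<open>open R\<close>] by simp
  qed
  define \<Phi>' where "\<Phi>' u = frechet_derivative \<Phi> (at u)" for u
  have der_\<Phi>: "(\<Phi> has_derivative \<Phi>' u) (at u)" if "u \<in> R" for u
    using diff_\<Phi>[OF that] by (simp add: \<Phi>'_def frechet_derivative_works)

  have sing: "\<not> inj (\<Phi>' u)" if u: "u \<in> Q" for u
  proof -
    have uR: "u \<in> R" and uS: "\<xi> u \<in> S" using u by (auto simp: Q_def R_def)
    obtain v where v: "v \<noteq> 0" "\<And>k. G'' (\<xi> u) v k + \<Phi> u \<bullet> h'' (\<xi> u) v k = 0"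
      using u by (auto simp: Q_def)
    \<comment> \<open>Along \<open>d\<close>, the point \<open>\<xi> u\<close> moves in the kernel
      direction \<open>v\<close> while the coordinates outside \<open>range e\<close> stay fixed.
      Differentiating the critical-point identity for \<open>\<Phi>\<close> in this direction, the
      second-order terms cancel by the choice of \<open>v\<close>, which leaves
      \<open>\<Phi>' u d\<close> orthogonal to the partial derivatives of \<open>h\<close>. It also
      vanishes outside \<open>range e\<close>, so invertibility of \<open>T u\<close> makes it zero
      although \<open>d\<close> is not.\<close>
    define d :: "real^'m" where "d = (\<chi> j. if j \<in> range e then v $ inv e j else 0)"
    have \<xi>d: "\<xi> d = v" using e by (simp add: \<xi>_def d_def vec_eq_iff)
    then have "d \<noteq> 0" using v(1) linear_0[OF bounded_linear.linear[OF lin]] by auto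
    have "\<Phi>' u d \<bullet> h' (\<xi> u) (axis i 1) = 0" for i
    proof -
      have "((\<lambda>y. G' (\<xi> y) (axis i 1) + \<Phi> y \<bullet> h' (\<xi> y) (axis i 1)) has_derivative
          (\<lambda>d. G'' (\<xi> u) (\<xi> d) (axis i 1) +
            (\<Phi> u \<bullet> h'' (\<xi> u) (\<xi> d) (axis i 1) + \<Phi>' u d \<bullet> h' (\<xi> u) (axis i 1)))) (at u)"
        by (intro has_derivative_add der_G[OF uS] has_derivative_inner der_\<Phi>[OF uR] der_h[OF uS])
      moreover have "((\<lambda>y. G' (\<xi> y) (axis i 1) + \<Phi> y \<bullet> h' (\<xi> y) (axis i 1)) has_derivative (\<lambda>d. 0)) (at u)"
        by (rule has_derivative_transform_within_open[OF has_derivative_const \<open>open R\<close> uR])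
          (rule sol[unfolded row_eq, THEN conjunct1, THEN spec, symmetric])
      ultimately have "G'' (\<xi> u) (\<xi> d) (axis i 1) +
            (\<Phi> u \<bullet> h'' (\<xi> u) (\<xi> d) (axis i 1) + \<Phi>' u d \<bullet> h' (\<xi> u) (axis i 1)) = 0"
        by (rule has_derivative_unique[THEN fun_cong])
      then show ?thesis using v(2)[of "axis i 1"] by (simp add: \<xi>d)
    qed
    moreover have "\<Phi>' u d $ j = 0" if "j \<notin> range e" for j
    proof -
      have "((\<lambda>y. \<Phi> y $ j) has_derivative (\<lambda>d. \<Phi>' u d $ j)) (at u)"
        by (rule bounded_linear.has_derivative[OF bounded_linear_vec_nth der_\<Phi>[OF uR]])
      moreover have "((\<lambda>y. \<Phi> y $ j) has_derivative (\<lambda>d. d $ j)) (at u)"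
        by (rule has_derivative_transform_within_open[OF
              bounded_linear_imp_has_derivative[OF bounded_linear_vec_nth] \<open>open R\<close> uR])
          (rule sol[unfolded row_eq, THEN conjunct2, THEN spec, THEN mp, OF _ that, symmetric])
      ultimately have "\<Phi>' u d $ j = d $ j" by (rule has_derivative_unique[THEN fun_cong])
      then show ?thesis using that by (simp add: d_def)
    qed
    ultimately have "T u *v \<Phi>' u d = 0"
      by (simp add: vec_eq_iff row)
    then have "\<Phi>' u d = 0" using T_solve[OF uR, of "\<Phi>' u d" 0] by simp
    moreover have "\<Phi>' u 0 = 0"
      by (rule linear_0[OF has_derivative_linear[OF der_\<Phi>[OF uR]]])
    ultimately show ?thesis using \<open>d \<noteq> 0\<close> injD[of "\<Phi>' u" d 0] by auto
  qed
  have "negligible (\<Phi> ` Q)"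
    by (rule negligible_image_singular[where f'=\<Phi>'])
      (use sing in \<open>auto simp: Q_def intro: has_derivative_at_withinI[OF der_\<Phi>]\<close>)
  moreover have "?Bad \<subseteq> \<Phi> ` Q"
  proof
    fix a assume "a \<in> ?Bad"
    then obtain x v where x: "x \<in> S"
      and reg: "\<And>b. (\<And>j. j \<notin> range e \<Longrightarrow> b $ j = 0) \<Longrightarrow> (\<And>k. b \<bullet> h' x k = 0) \<Longrightarrow> b = 0"
      and crit: "\<And>k. G' x k + a \<bullet> h' x k = 0"
      and v: "v \<noteq> 0" "\<And>k. G'' x v k + a \<bullet> h'' x v k = 0" by blast
    define u :: "real^'m" where "u = (\<chi> j. if j \<in> range e then x $ inv e j else a $ j)"
    have \<xi>u: "\<xi> u = x" using e by (simp add: \<xi>_def u_def vec_eq_iff)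
    \<comment> \<open>By \<open>reg\<close> the kernel of \<open>T u\<close> is trivial, so
      \<open>u\<close>, packed from \<open>x\<close> and \<open>a\<close>, lies in \<open>R\<close>;
      uniqueness of the solution then gives \<open>\<Phi> u = a\<close>.\<close>
    have "b = 0" if "T u *v b = 0" for b
    proof (rule reg)
      have *: "(T u *v b) $ j = 0" for j using that by simp
      show "b $ j = 0" if "j \<notin> range e" for j using *[of j] that by (simp add: row)
      have "b \<bullet> h' x (axis i 1) = 0" for i using *[of "e i"] e by (simp add: row \<xi>u)
      then show "b \<bullet> h' x k = 0" for k
        by (subst basis_expansion[of k, symmetric])
          (simp add: blinfun.sum_right blinfun.scaleR_right inner_sum_right scalar_mult_eq_scaleR)
    qed
    then have "invertible (T u)"
      using matrix_left_invertible_ker[of "T u"] invertible_left_inverse[of "T u"] by blast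
    then have uR: "u \<in> R" using x by (simp add: R_def \<xi>u invertible_det_nz)
    have "T u *v a = w u"
      unfolding row_eq \<xi>u using crit by (simp add: u_def)
    then have "\<Phi> u = a" using T_solve[OF uR] \<Phi>_def by metis
    moreover from this have "u \<in> Q" using uR v by (auto simp: Q_def \<xi>u)
    ultimately show "a \<in> \<Phi> ` Q" by blast
  qed
  ultimately show ?thesis using negligible_subset by blast
qed

text \<open>Injectivity of the differential supplies a suitable \<open>e\<close> at each point. The
  choice varies with the point, but there are only finitely many maps \<open>e\<close>, so the
  negligible sets obtained for each of them can be united.\<close>

lemma degenerate_perturbations_negligible:
  fixes h :: "real^'n::finite \<Rightarrow> real^'m::finite" and F :: "real^'m \<Rightarrow> real"
  assumes "C2_on h S" "C2_on F U" "h ` S \<subseteq> U" and S: "open S"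
    and imm: "\<And>x. x \<in> S \<Longrightarrow> inj (frechet_derivative h (at x))"
  shows "negligible {a. \<exists>x\<in>S. frechet_derivative ((\<lambda>y. F y + a \<bullet> y) \<circ> h) (at x) = (\<lambda>v. 0) \<and>
      det (hessian_matrix ((\<lambda>y. F y + a \<bullet> y) \<circ> h) x) = 0}" (is "negligible ?Bad")
proof -
  obtain h' h'' where h: "C2_derivs h h' h'' S"
    using assms(1) by (auto simp: C2_on_iff_C2_derivs)
  obtain F' F'' where F: "C2_derivs F F' F'' U"
    using assms(2) by (auto simp: C2_on_iff_C2_derivs)
  obtain G'' where G: "C2_derivs (F \<circ> h) (\<lambda>x. F' (h x) o\<^sub>L h' x) G'' S"
    and G'': "\<And>x v. G'' x v = (F' (h x) o\<^sub>L h'' x v) + (F'' (h x) (h' x v) o\<^sub>L h' x)"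
    by (rule C2_derivs_compose[OF h F assms(3)]) (rule that)
  let ?N = "\<lambda>e :: 'n \<Rightarrow> 'm. {a. \<exists>x\<in>S.
      (\<forall>b. (\<forall>j. j \<notin> range e \<longrightarrow> b $ j = 0) \<and> (\<forall>k. b \<bullet> h' x k = 0) \<longrightarrow> b = 0) \<and>
      (\<forall>k. (F' (h x) o\<^sub>L h' x) k + a \<bullet> h' x k = 0) \<and>
      (\<exists>v. v \<noteq> 0 \<and> (\<forall>k. G'' x v k + a \<bullet> h'' x v k = 0))}"
  have "negligible (\<Union>e\<in>{e. inj e}. ?N e)"
    using degenerate_perturbations_negligible_coord[OF h G S]
    by (intro negligible_Union) auto
  moreover have "?Bad \<subseteq> (\<Union>e\<in>{e. inj e}. ?N e)"
  proof
    fix a assume "a \<in> ?Bad"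
    let ?g = "(\<lambda>y. F y + a \<bullet> y) \<circ> h"
    from \<open>a \<in> ?Bad\<close> obtain x where x: "x \<in> S"
      and crit: "frechet_derivative ?g (at x) = (\<lambda>v. 0)" and deg: "det (hessian_matrix ?g x) = 0"
      by blast
    obtain g'' where g: "C2_derivs ?g (\<lambda>x. (F' (h x) + blinfun_inner_right a) o\<^sub>L h' x) g'' S"
      and g'': "\<And>x v. g'' x v =
        ((F' (h x) + blinfun_inner_right a) o\<^sub>L h'' x v) + (F'' (h x) (h' x v) o\<^sub>L h' x)"
      by (rule C2_derivs_compose[OF h C2_derivs_add_inner[OF F] assms(3)]) (rule that)
    have "\<forall>k. (F' (h x) o\<^sub>L h' x) k + a \<bullet> h' x k = 0"
      using crit unfolding C2_derivs_frechet[OF g x]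
      by (auto simp: fun_eq_iff blinfun.add_left)
    moreover obtain v where "v \<noteq> 0" "g'' x v = 0"
      using deg unfolding det_hessian_eq_0_iff[OF g S x] by blast
    \<comment> \<open>The map \<open>y \<mapsto> a \<bullet> y\<close> has zero second derivative,
      so the perturbation enters only through the first summand of the chain rule, as
      \<open>a \<bullet> h'' x v k\<close>.\<close>
    have "G'' x v k + a \<bullet> h'' x v k = g'' x v k" for k
      by (simp add: G'' g'' blinfun.add_left)
    then have "v \<noteq> 0 \<and> (\<forall>k. G'' x v k + a \<bullet> h'' x v k = 0)"
      using \<open>v \<noteq> 0\<close> \<open>g'' x v = 0\<close> by simp
    moreover have "inj (h' x)" using imm[OF x] by (simp add: C2_derivs_frechet[OF h x])
    obtain e :: "'n \<Rightarrow> 'm" where "inj e"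
      "\<forall>b. (\<forall>j. j \<notin> range e \<longrightarrow> b $ j = 0) \<and> (\<forall>k. b \<bullet> h' x k = 0) \<longrightarrow> b = 0"
      by (rule coordinate_complement_of_range[OF
            bounded_linear.linear[OF blinfun.bounded_linear_right] \<open>inj (h' x)\<close>]) (rule that)
    ultimately show "a \<in> (\<Union>e\<in>{e. inj e}. ?N e)"
      using x by blast
  qed
  ultimately show ?thesis using negligible_subset by blast
qed

section \<open>Charts, coordinate changes and countable atlases\<close>

lemma chart_inv_into:
  assumes "is_chart N (V, \<phi>)" "p \<in> V"
  shows "inv_into V \<phi> (\<phi> p) = p"
proof -
  have "V \<subseteq> topspace N" using assms by (auto simp: is_chart_def openin_subset)
  then have "inj_on \<phi> V"
    using assms homeomorphic_imp_injective_map[of "subtopology N V"]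
    by (fastforce simp: is_chart_def Int_absorb1)
  then show ?thesis using assms by simp
qed

lemma local_rep_chart:
  assumes "is_chart N (V, \<phi>)" "p \<in> V"
  shows "local_rep f (V, \<phi>) (\<phi> p) = f p"
  using chart_inv_into[OF assms] by (simp add: local_rep_def)

lemma open_chart_image:
  assumes c: "is_chart N (V, \<phi>)" and W: "openin N W"
  shows "open (\<phi> ` (V \<inter> W))"
proof -
  have hom: "homeomorphic_map (subtopology N V) (top_of_set (\<phi> ` V)) \<phi>" and V: "openin N V" "open (\<phi> ` V)"
    using c by (auto simp: is_chart_def)
  have "openin (subtopology N V) (V \<inter> W)"
    using W by (auto simp: openin_subtopology)
  then have "openin (top_of_set (\<phi> ` V)) (\<phi> ` (V \<inter> W))"
    using homeomorphic_imp_open_map[OF hom] by (simp add: open_map_def)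
  then show ?thesis using V(2) openin_open_eq by blast
qed

text \<open>At a critical point the Hessian transforms by congruence with the Jacobian of the transition
  map, because the term carrying the second derivative of the transition map is multiplied by the
  vanishing differential.\<close>

lemma critical_nondegenerate_chart_change:
  fixes A :: "('a, 'n::finite) chart set" and g :: "'a \<Rightarrow> real"
  assumes M: "C2_manifold N A" and V: "(V, \<phi>) \<in> A" and W: "(W, \<psi>) \<in> A" and g: "C2_map A g"
    and p: "p \<in> V" "p \<in> W"
    and crit: "frechet_derivative (local_rep g (V, \<phi>)) (at (\<phi> p)) = (\<lambda>v. 0)"
  shows "frechet_derivative (local_rep g (W, \<psi>)) (at (\<psi> p)) = (\<lambda>v. 0)"
    and "det (hessian_matrix (local_rep g (V, \<phi>)) (\<phi> p)) \<noteq> 0 \<Longrightarrow>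
      det (hessian_matrix (local_rep g (W, \<psi>)) (\<psi> p)) \<noteq> 0"
proof -
  have cV: "is_chart N (V, \<phi>)" and cW: "is_chart N (W, \<psi>)"
    and C2: "C2_on (local_rep \<phi> (W, \<psi>)) (\<psi> ` (W \<inter> V))" "C2_on (local_rep \<psi> (V, \<phi>)) (\<phi> ` (V \<inter> W))"
    using M V W by (auto simp: C2_manifold_def)
  have oN: "openin N V" "openin N W" using cV cW by (auto simp: is_chart_def)
  let ?O = "\<psi> ` (W \<inter> V)" and ?P = "\<phi> ` (V \<inter> W)"
  let ?\<tau> = "local_rep \<phi> (W, \<psi>)" and ?\<sigma> = "local_rep \<psi> (V, \<phi>)"
  have O: "open ?O" "open ?P" using open_chart_image oN cV cW by blast+
  have pO: "\<psi> p \<in> ?O" "\<phi> p \<in> ?P" using p by auto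
  have \<tau>: "?\<tau> (\<psi> q) = \<phi> q" "?\<sigma> (\<phi> q) = \<psi> q"
    "local_rep g (V, \<phi>) (\<phi> q) = g q" "local_rep g (W, \<psi>) (\<psi> q) = g q" if "q \<in> V" "q \<in> W" for q
    using that by (simp_all add: local_rep_chart[OF cV] local_rep_chart[OF cW])
  have "C2_on (local_rep g (V, \<phi>)) (\<phi> ` V)" using g V by (auto simp: C2_map_def)
  then obtain gV' gV'' where gV: "C2_derivs (local_rep g (V, \<phi>)) gV' gV'' (\<phi> ` V)"
    by (auto simp: C2_on_iff_C2_derivs)
  obtain \<tau>' \<tau>'' where d\<tau>: "C2_derivs ?\<tau> \<tau>' \<tau>'' ?O" using C2(1) by (auto simp: C2_on_iff_C2_derivs)
  obtain \<sigma>' \<sigma>'' where d\<sigma>: "C2_derivs ?\<sigma> \<sigma>' \<sigma>'' ?P" using C2(2) by (auto simp: C2_on_iff_C2_derivs)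
  have im: "?\<tau> ` ?O \<subseteq> \<phi> ` V" using \<tau> by auto
  obtain h'' where h: "C2_derivs (local_rep g (V, \<phi>) \<circ> ?\<tau>) (\<lambda>x. gV' (?\<tau> x) o\<^sub>L \<tau>' x) h'' ?O"
    and h'': "\<And>x v. h'' x v = (gV' (?\<tau> x) o\<^sub>L \<tau>'' x v) + (gV'' (?\<tau> x) (\<tau>' x v) o\<^sub>L \<tau>' x)"
    by (rule C2_derivs_compose[OF d\<tau> gV im]) (rule that)
  \<comment> \<open>On the overlap, the representation in \<open>(W, \<psi>)\<close> is the one in
    \<open>(V, \<phi>)\<close> after the transition map, so it inherits the derivatives given by the
    chain rule.\<close>
  have gW: "C2_derivs (local_rep g (W, \<psi>)) (\<lambda>x. gV' (?\<tau> x) o\<^sub>L \<tau>' x) h'' ?O"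
    by (rule C2_derivs_cong[OF h O(1)]) (use \<tau> in auto)
  have crit': "gV' (\<phi> p) = 0"
    using crit C2_derivs_frechet_eq_0_iff[OF gV] p by blast
  show "frechet_derivative (local_rep g (W, \<psi>)) (at (\<psi> p)) = (\<lambda>v. 0)"
    unfolding C2_derivs_frechet_eq_0_iff[OF gW pO(1)] using p by (simp add: \<tau> crit')
  assume nd: "det (hessian_matrix (local_rep g (V, \<phi>)) (\<phi> p)) \<noteq> 0"
  show "det (hessian_matrix (local_rep g (W, \<psi>)) (\<psi> p)) \<noteq> 0"
    unfolding det_hessian_eq_0_iff[OF gW O(1) pO(1)]
  proof safe
    fix v assume v: "v \<noteq> 0" "h'' (\<psi> p) v = 0"
    \<comment> \<open>Near \<open>\<psi> p\<close> the map \<open>?\<sigma>\<close> inverts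
      \<open>?\<tau>\<close>; hence \<open>\<tau>' (\<psi> p)\<close> is injective, and surjective
      because the dimensions agree.\<close>
    have "((\<lambda>y. ?\<sigma> (?\<tau> y)) has_derivative (\<lambda>v. \<sigma>' (\<phi> p) (\<tau>' (\<psi> p) v))) (at (\<psi> p))"
      using has_derivative_compose[OF C2_derivsD(1)[OF d\<tau> pO(1)], of ?\<sigma> "\<sigma>' (\<phi> p)"]
        C2_derivsD(1)[OF d\<sigma> pO(2)] p by (simp add: \<tau>)
    moreover have "((\<lambda>y. ?\<sigma> (?\<tau> y)) has_derivative (\<lambda>v. v)) (at (\<psi> p))"
      by (rule has_derivative_transform_within_open[OF has_derivative_ident O(1) pO(1)]) (use \<tau> in auto)
    ultimately have inv: "(\<lambda>v. \<sigma>' (\<phi> p) (\<tau>' (\<psi> p) v)) = (\<lambda>v. v)"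
      by (rule has_derivative_unique)
    then have inj: "inj (\<tau>' (\<psi> p))" by (metis injI)
    have lin: "linear (\<tau>' (\<psi> p))" by (simp add: bounded_linear.linear blinfun.bounded_linear_right)
    have surj: "surj (\<tau>' (\<psi> p))" using linear_injective_imp_surjective[OF lin inj] by simp
    have "\<tau>' (\<psi> p) v \<noteq> 0"
      using v(1) inv by (metis blinfun.zero_right)
    \<comment> \<open>Since \<open>gV' (\<phi> p) = 0\<close>, only the second summand of
      \<open>h''\<close> survives. Surjectivity cancels its right factor, so
      \<open>\<tau>' (\<psi> p) v\<close> is a nonzero kernel vector in the chart
      \<open>(V, \<phi>)\<close>, contrary to \<open>nd\<close>.\<close>
    moreover have "gV'' (\<phi> p) (\<tau>' (\<psi> p) v) o\<^sub>L \<tau>' (\<psi> p) = 0"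
      using v(2) p unfolding h'' by (simp add: \<tau> crit')
    then have "gV'' (\<phi> p) (\<tau>' (\<psi> p) v) (\<tau>' (\<psi> p) k) = 0" for k
      by (metis blinfun_apply_blinfun_compose blinfun.zero_left)
    then have "gV'' (\<phi> p) (\<tau>' (\<psi> p) v) = 0"
      using surj by (intro blinfun_eqI) (metis blinfun.zero_left surjD)
    ultimately show False
      using nd det_hessian_eq_0_iff[OF gV] p cV by (auto simp: is_chart_def)
  qed
qed

text \<open>Second countable spaces are Lindelof. Countability will keep the union of the
  exceptional sets of the charts negligible.\<close>

lemma countable_subatlas:
  assumes "C2_manifold N A"
  obtains A' where "countable A'" "A' \<subseteq> A" "(\<Union>(V, \<phi>)\<in>A'. V) = topspace N"
proof -
  have lind: "Lindelof_space N" using assms by (simp add: C2_manifold_def second_countable_imp_Lindelof_space)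
  have "\<And>U. U \<in> fst ` A \<Longrightarrow> openin N U" and cov: "\<Union>(fst ` A) = topspace N"
    using assms by (force simp: C2_manifold_def is_chart_def case_prod_unfold)+
  then obtain \<V> where \<V>: "countable \<V>" "\<V> \<subseteq> fst ` A" "\<Union>\<V> = topspace N"
    using Lindelof_spaceD[OF lind, of "fst ` A"] by metis
  then obtain A' where "countable A'" "A' \<subseteq> A" "fst ` A' = \<V>"
    by (metis countable_subset_image)
  then show ?thesis using that \<V> by (force simp: case_prod_unfold)
qed

section \<open>Assembling the exceptional set of linear forms\<close>

theorem corollary1:
  fixes N :: "'a topology" and A :: "('a, 'n::finite) chart set"
    and f :: "'a \<Rightarrow> real ^ 'm::finite" and U :: "(real ^ 'm) set" and F :: "real ^ 'm \<Rightarrow> real"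
  assumes "C2_manifold N A"
    and "open U"
    and "f \<in> topspace N \<rightarrow> U"
    and "C2_immersion A f"
    and "C2_on F U"
  shows "\<exists>\<Sigma> \<subseteq> {\<pi> :: real ^ 'm \<Rightarrow> real. linear \<pi>}.
           form_coords ` \<Sigma> \<in> null_sets lebesgue \<and>
           (\<forall>\<pi> \<in> {\<pi>. linear \<pi>} - \<Sigma>. morse_function A ((\<lambda>x. F x + \<pi> x) \<circ> f))"
proof -
  let ?g = "\<lambda>a y. F y + a \<bullet> y"
  define Bad where "Bad c = {a. \<exists>x \<in> snd c ` fst c.
      frechet_derivative (?g a \<circ> local_rep f c) (at x) = (\<lambda>v. 0) \<and>
      det (hessian_matrix (?g a \<circ> local_rep f c) x) = 0}" for c :: "('a, 'n) chart"
  have rep_comp: "local_rep (k \<circ> f) c = k \<circ> local_rep f c" for k :: "real^'m \<Rightarrow> real" and c :: "('a, 'n) chart"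
    by (simp add: local_rep_def comp_assoc)
  have chart: "is_chart N (V, \<phi>)" "V \<subseteq> topspace N" "open (\<phi> ` V)" "C2_on (local_rep f (V, \<phi>)) (\<phi> ` V)"
    "local_rep f (V, \<phi>) ` \<phi> ` V \<subseteq> U" if "(V, \<phi>) \<in> A" for V \<phi>
  proof -
    show c: "is_chart N (V, \<phi>)" using assms(1) that by (auto simp: C2_manifold_def)
    show "V \<subseteq> topspace N" "open (\<phi> ` V)" using c by (auto simp: is_chart_def openin_subset)
    show "C2_on (local_rep f (V, \<phi>)) (\<phi> ` V)"
      using assms(4) that by (auto simp: C2_immersion_def C2_map_def)
    show "local_rep f (V, \<phi>) ` \<phi> ` V \<subseteq> U"
      using assms(3) \<open>V \<subseteq> topspace N\<close> by (auto simp: local_rep_chart[OF c])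
  qed
  have Bad: "negligible (Bad c)" if "c \<in> A" for c
  proof (cases c)
    case (Pair V \<phi>)
    then have c: "(V, \<phi>) \<in> A" using that by simp
    have "inj (frechet_derivative (local_rep f (V, \<phi>)) (at x))" if "x \<in> \<phi> ` V" for x
      using assms(4) c that by (auto simp: C2_immersion_def)
    from degenerate_perturbations_negligible[OF chart(4)[OF c] assms(5) chart(5)[OF c] chart(3)[OF c] this]
    show ?thesis by (simp add: Bad_def Pair)
  qed
  have g_C2: "C2_map A (?g a \<circ> f)" for a
    unfolding C2_map_def rep_comp
  proof safe
    fix V \<phi> assume c: "(V, \<phi>) \<in> A"
    obtain h' h'' F' F'' where h: "C2_derivs (local_rep f (V, \<phi>)) h' h'' (\<phi> ` V)"
      and F: "C2_derivs F F' F'' U"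
      using chart(4)[OF c] assms(5) by (auto simp: C2_on_iff_C2_derivs)
    show "C2_on (?g a \<circ> local_rep f (V, \<phi>)) (\<phi> ` V)"
      by (rule C2_derivs_compose[OF h C2_derivs_add_inner[OF F] chart(5)[OF c]])
        (auto simp: C2_on_iff_C2_derivs)
  qed
  obtain A' where A': "countable A'" "A' \<subseteq> A" "(\<Union>(V, \<phi>)\<in>A'. V) = topspace N"
    using countable_subatlas[OF assms(1)] .
  let ?B = "\<Union>c\<in>A'. Bad c"
  have neg: "negligible ?B"
    using A' Bad by (intro negligible_countable_Union) auto
  have morse: "morse_function A (?g a \<circ> f)" if a: "a \<notin> ?B" for a
    unfolding morse_function_def critical_point_def nondegenerate_at_def
  proof safe
    show "C2_map A (?g a \<circ> f)" by (rule g_C2)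
    fix p V \<phi> W \<psi>
    assume V: "(V, \<phi>) \<in> A" "p \<in> V" and W: "(W, \<psi>) \<in> A" "p \<in> W"
      and crit: "frechet_derivative (local_rep (?g a \<circ> f) (V, \<phi>)) (at (\<phi> p)) = (\<lambda>v. 0)"
      and deg: "det (hessian_matrix (local_rep (?g a \<circ> f) (W, \<psi>)) (\<psi> p)) = 0"
    \<comment> \<open>Criticality is given in \<open>(V, \<phi>)\<close> and degeneracy in
      \<open>(W, \<psi>)\<close>, and neither chart need belong to \<open>A'\<close>. Both
      properties are moved to one chart of \<open>A'\<close> around \<open>p\<close>, the second by
      contraposition: nondegeneracy there would carry over to \<open>(W, \<psi>)\<close>.\<close>
    have "p \<in> (\<Union>(V, \<phi>)\<in>A'. V)" unfolding A'(3) using chart(2) V by blast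
    then obtain X \<eta> where X': "(X, \<eta>) \<in> A'" and p: "p \<in> X"
      by (auto simp only: UN_iff split_beta) (metis prod.collapse)
    then have X: "(X, \<eta>) \<in> A" using A'(2) by blast
    have critX: "frechet_derivative (local_rep (?g a \<circ> f) (X, \<eta>)) (at (\<eta> p)) = (\<lambda>v. 0)"
      by (rule critical_nondegenerate_chart_change(1)[OF assms(1) V(1) X g_C2 V(2) p crit])
    have "det (hessian_matrix (local_rep (?g a \<circ> f) (X, \<eta>)) (\<eta> p)) = 0"
      using critical_nondegenerate_chart_change(2)[OF assms(1) X W(1) g_C2 p W(2) critX] deg by blast
    then have "a \<in> Bad (X, \<eta>)"
      using critX p by (auto simp: Bad_def rep_comp)
    then show False using a X' by blast
  qed
  \<comment> \<open>\<open>?\<Sigma>\<close> is the pullback of \<open>?B\<close> along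
    \<open>form_coords\<close>, so its coordinate image is a subset of a negligible set. By
    \<open>form\<close>, the perturbation by a linear form is \<open>?g\<close> at its coordinate
    vector.\<close>
  let ?\<Sigma> = "{\<pi>. linear \<pi> \<and> form_coords \<pi> \<in> ?B}"
  have form: "\<pi> y = form_coords \<pi> \<bullet> y" if "linear \<pi>" for \<pi> :: "real^'m \<Rightarrow> real" and y
  proof -
    have "\<pi> y = \<pi> (\<Sum>i\<in>UNIV. y $ i *\<^sub>R axis i 1)"
      by (metis basis_expansion scalar_mult_eq_scaleR)
    then show ?thesis
      using that by (simp add: linear_sum linear_cmul form_coords_def inner_vec_def mult.commute)
  qed
  have "negligible (form_coords ` ?\<Sigma>)"
    by (rule negligible_subset[OF neg]) auto
  then have "form_coords ` ?\<Sigma> \<in> null_sets lebesgue"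
    by (simp add: negligible_iff_null_sets)
  moreover have "morse_function A ((\<lambda>x. F x + \<pi> x) \<circ> f)" if "\<pi> \<in> {\<pi>. linear \<pi>} - ?\<Sigma>" for \<pi>
  proof -
    have "linear \<pi>" "form_coords \<pi> \<notin> ?B" using that by auto
    moreover from this have "(\<lambda>x. F x + \<pi> x) = ?g (form_coords \<pi>)"
      using form by auto
    ultimately show ?thesis using morse by simp
  qed
  ultimately show ?thesis by (intro exI[of _ ?\<Sigma>]) auto
qed

end
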